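(* Let $G$ be a finite abelian group with $b\ge2$ elements, let $p_b$ be the smallest prime factor of $b$, let $\alpha_b:=(\log p_b)/2$, and let $c>0$ be an arbitrary real number. Then for all positive integers $s,n,d$ with $d\ge(1+c)(b-1)s/(\alpha_b\log b)$, there exists a subgroup $P\subset G^{s\times n}$ with $|P|\le b^d$ satisfying $$\mathrm{WF}(P)\le\left(1+\frac{1+c}{c}\,\frac1{\log b}\right)b^{-\alpha_b^2d^2/((b-1)s)}\,e^{2\alpha_bd}.$$
   Context: $\log$ is the natural logarithm. $G^\vee=\mathrm{Hom}(G,T)$, with $T=\{z\in\mathbb{C}:|z|=1\}$, is the character group of $G$, written additively, and $h\bullet g:=h(g)$. The character group of $G^{s\times n}$ ($s\times n$ matrices over $G$) is identified with $(G^\vee)^{s\times n}$ via $A\bullet B=\prod_{i,j}a_{i,j}\bullet b_{i,j}$. $P^\perp=\{A\in(G^\vee)^{s\times n}:A\bullet B=1\text{ for all }B\in P\}$. The Dick weight of $A=(a_{i,j})\in(G^\vee)^{s\times n}$ is $\mu(A)=\sum_{i,j}j\,\delta(a_{i,j})$ with $\delta(0)=0$ and $\delta(h)=1$ for $h\neq0$. The Walsh figure of merit (WAFOM) is $\mathrm{WF}(P)=\sum_{A\in P^\perp\setminus\{O\}}b^{-\mu(A)}$, where $O$ is the zero matrix. *)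

theory Defs
  imports Complex_Main
    "HOL-Computational_Algebra.Primes"
    "HOL-Algebra.Multiplicative_Group"
    "HOL-Algebra.Product_Groups"
begin

text \<open>Groups are written multiplicatively, as everywhere in HOL-Algebra; so the zero of the
  character group is \<open>\<one>\<^bsub>character_group G\<^esub>\<close>.\<close>

definition circle_group :: "complex monoid" where
  "circle_group = \<lparr>carrier = {z. cmod z = 1}, monoid.mult = (\<lambda>x y. x * y), one = 1\<rparr>"

text \<open>Characters are taken extensional, so that two characters are equal iff they agree on
  \<open>carrier G\<close>.\<close>

definition character_group :: "('a, 'm) monoid_scheme \<Rightarrow> ('a \<Rightarrow> complex) monoid" where
  "character_group G =
     \<lparr>carrier = hom G circle_group \<inter> extensional (carrier G),
      monoid.mult = (\<lambda>h k. \<lambda>g\<in>carrier G. h g * k g),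
      one = (\<lambda>g\<in>carrier G. 1)\<rparr>"

definition matrix_group ::
  "nat \<Rightarrow> nat \<Rightarrow> ('a, 'm) monoid_scheme \<Rightarrow> (nat \<times> nat \<Rightarrow> 'a) monoid" where
  "matrix_group s n G = product_group ({1..s} \<times> {1..n}) (\<lambda>_. G)"

definition matrix_pairing ::
  "nat \<Rightarrow> nat \<Rightarrow> (nat \<times> nat \<Rightarrow> 'a \<Rightarrow> complex) \<Rightarrow> (nat \<times> nat \<Rightarrow> 'a) \<Rightarrow> complex" where
  "matrix_pairing s n A B = (\<Prod>i = 1..s. \<Prod>j = 1..n. A (i, j) (B (i, j)))"

definition perp ::
  "('a, 'm) monoid_scheme \<Rightarrow> nat \<Rightarrow> nat \<Rightarrow> (nat \<times> nat \<Rightarrow> 'a) set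
     \<Rightarrow> (nat \<times> nat \<Rightarrow> 'a \<Rightarrow> complex) set" where
  "perp G s n P =
     {A \<in> carrier (matrix_group s n (character_group G)). \<forall>B\<in>P. matrix_pairing s n A B = 1}"

definition dick_weight ::
  "('a, 'm) monoid_scheme \<Rightarrow> nat \<Rightarrow> nat \<Rightarrow> (nat \<times> nat \<Rightarrow> 'a \<Rightarrow> complex) \<Rightarrow> nat" where
  "dick_weight G s n A =
     (\<Sum>i = 1..s. \<Sum>j = 1..n. j * (if A (i, j) = \<one>\<^bsub>character_group G\<^esub> then 0 else 1))"

text \<open>The index set is finite for finite \<open>G\<close>; see \<open>finite_perp\<close> below.\<close>

definition wafom ::
  "('a, 'm) monoid_scheme \<Rightarrow> nat \<Rightarrow> nat \<Rightarrow> (nat \<times> nat \<Rightarrow> 'a) set \<Rightarrow> real" where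
  "wafom G s n P =
     (\<Sum>A \<in> perp G s n P - {\<one>\<^bsub>matrix_group s n (character_group G)\<^esub>}.
        real (card (carrier G)) powr (- real (dick_weight G s n A)))"

definition smallest_prime_factor :: "nat \<Rightarrow> nat" where
  "smallest_prime_factor b = Min (prime_factors b)"

definition wafom_alpha :: "nat \<Rightarrow> real" where
  "wafom_alpha b = ln (real (smallest_prime_factor b)) / 2"

lemma comm_group_circle_group: "comm_group circle_group"
proof (rule comm_groupI)
  fix x assume "x \<in> carrier circle_group"
  then show "\<exists>y\<in>carrier circle_group. y \<otimes>\<^bsub>circle_group\<^esub> x = \<one>\<^bsub>circle_group\<^esub>"
    by (intro bexI[of _ "inverse x"])
      (auto simp: circle_group_def norm_inverse intro!: left_inverse)
qed (auto simp: circle_group_def norm_mult)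

lemma comm_group_character_group:
  fixes G (structure)
  assumes "group G"
  shows "comm_group (character_group G)"
proof -
  interpret group G by fact
  show ?thesis
  proof (rule comm_groupI)
    fix h assume h: "h \<in> carrier (character_group G)"
    then have nz: "h g \<noteq> 0" if "g \<in> carrier G" for g
    proof -
      have "cmod (h g) = 1"
        using h that by (auto simp: character_group_def circle_group_def hom_def Pi_iff)
      then show ?thesis by auto
    qed
    show "\<exists>k\<in>carrier (character_group G). k \<otimes>\<^bsub>character_group G\<^esub> h = \<one>\<^bsub>character_group G\<^esub>"
    proof (rule bexI[of _ "\<lambda>g\<in>carrier G. inverse (h g)"])
      show "(\<lambda>g\<in>carrier G. inverse (h g)) \<in> carrier (character_group G)"
        using h by (auto simp: character_group_def circle_group_def hom_def norm_inverse Pi_iff)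
    qed (use nz in \<open>auto simp: character_group_def restrict_def\<close>)
  qed (auto simp: character_group_def circle_group_def hom_def norm_mult Pi_iff extensional_def
        restrict_def mult_ac fun_eq_iff)
qed

lemma finite_character_group:
  fixes G (structure)
  assumes "group G" "finite (carrier G)"
  shows "finite (carrier (character_group G))"
proof -
  interpret group G by fact
  interpret T: comm_group circle_group by (rule comm_group_circle_group)
  have pow: "x [^]\<^bsub>circle_group\<^esub> (k::nat) = x ^ k" for x k
    by (induction k) (auto simp: circle_group_def nat_pow_def)
  let ?R = "{z::complex. z ^ order G = 1}"
  have "order G \<ge> 1"
    using assms(2) order_gt_0_iff_finite by linarith
  then have "finite ?R"
    by (rule finite_roots_unity)
  moreover have "carrier (character_group G) \<subseteq> carrier G \<rightarrow>\<^sub>E ?R"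
  proof
    fix h assume h: "h \<in> carrier (character_group G)"
    then have hom: "h \<in> hom G circle_group" and ext: "h \<in> extensional (carrier G)"
      by (auto simp: character_group_def)
    have "h g ^ order G = 1" if g: "g \<in> carrier G" for g
    proof -
      interpret H: group_hom G circle_group h
        using hom by unfold_locales
      have "h g ^ order G = h (g [^] order G)"
        using g by (simp add: H.hom_nat_pow pow)
      also have "\<dots> = 1"
        using g H.hom_one by (simp add: pow_order_eq_1 circle_group_def)
      finally show ?thesis .
    qed
    with ext show "h \<in> carrier G \<rightarrow>\<^sub>E ?R"
      by (auto simp: PiE_iff)
  qed
  ultimately show ?thesis
    using assms(2) finite_PiE finite_subset by (metis (no_types, lifting))
qed

lemma finite_perp:
  assumes "group G" "finite (carrier G)"
  shows "finite (perp G s n P)"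
proof (rule finite_subset)
  show "perp G s n P \<subseteq> carrier (matrix_group s n (character_group G))"
    by (auto simp: perp_def)
  show "finite (carrier (matrix_group s n (character_group G)))"
    using finite_character_group[OF assms] by (auto simp: matrix_group_def intro!: finite_PiE)
qed

end

theory Submission
  imports Defs
begin

text \<open>
  Write \<open>C = (b - 1) s\<close>, \<open>\<alpha> = wafom_alpha b\<close> and \<open>X = (\<alpha> d)\<^sup>2 / C\<close>. The sum defining the figure of
  merit is small as soon as \<open>P\<^sup>\<bottom>\<close> has no nonzero matrix of small Dick weight, so the theorem rests on
  two estimates: how large the minimum weight can be made, and how many matrices there are of each
  weight.

  Existence. A nontrivial character of a finite group equals 1 on at most a fraction \<open>1/p\<close> of the
  elements, where \<open>p\<close> is the smallest prime dividing the order. By averaging, some element is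
  annihilated by at most a fraction \<open>1/p\<close> of any given finite set of nontrivial characters. After
  \<open>d\<close> such choices, fewer than \<open>p\<^sup>d\<close> characters are reduced to none, and the subgroup generated by the
  chosen elements has at most \<open>b\<^sup>d\<close> elements because \<open>x\<^sup>b = 1\<close> throughout
  (\<open>exists_small_subgroup_detecting\<close>). Hence the weights on \<open>P\<^sup>\<bottom>\<close> exceed \<open>m\<close> apart from the zero matrix
  whenever at most \<open>p\<^sup>d = e\<^bsup>2\<alpha>d\<^esup>\<close> matrices have weight at most \<open>m\<close>.

  Counting. The dual group has at most \<open>b\<close> elements (\<open>card_character_group_le\<close>). So the weight
  enumerator of the matrices over it, which is a product over the entries, is at most
  \<open>\<Prod>\<^sub>j (1 + (b - 1) z\<^sup>j)\<^sup>s \<le> exp (C \<Sum>\<^sub>j z\<^sup>j)\<close>, and choosing \<open>z = exp (- sqrt (C / m))\<close> shows that at most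
  \<open>exp (2 sqrt (C m))\<close> matrices have weight at most \<open>m\<close> (\<open>card_dick_weight_le\<close>). This is at most
  \<open>e\<^bsup>2\<alpha>d\<^esup>\<close> exactly when \<open>m \<le> X\<close>, so \<open>m = \<lfloor>X\<rfloor>\<close> is admissible above.

  Conclusion. The figure of merit of this \<open>P\<close> is at most \<open>\<Sum>\<^bsub>k > m\<^esub> f k\<close> with
  \<open>f k = exp (2 sqrt (C k)) b\<^bsup>-k\<^esup>\<close>. The hypothesis on \<open>d\<close> says that the slope \<open>sqrt (C / X)\<close> of
  \<open>2 sqrt (C k)\<close> at \<open>X\<close> is at most \<open>ln b / (1 + c)\<close>. By concavity, \<open>f\<close> then decays beyond \<open>X\<close> at least
  as fast as the geometric sequence with ratio \<open>e\<^bsup>-t\<^esup>\<close>, \<open>t = c ln b / (1 + c)\<close>. Summing gives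
  \<open>f X / (1 - e\<^bsup>-t\<^esup>) \<le> (1 + 1/t) f X\<close>, which is the asserted bound.
\<close>

section \<open>Characters of a finite abelian group\<close>

lemma circle_hom_mult:
  assumes "\<chi> \<in> hom G circle_group" "x \<in> carrier G" "y \<in> carrier G"
  shows "\<chi> (x \<otimes>\<^bsub>G\<^esub> y) = \<chi> x * \<chi> y"
  using assms by (auto simp: hom_def circle_group_def)

lemma circle_hom_norm:
  assumes "\<chi> \<in> hom G circle_group" "x \<in> carrier G"
  shows "cmod (\<chi> x) = 1"
  using assms by (auto simp: hom_def circle_group_def)

lemma group_hom_circle_group:
  assumes "group G" "\<chi> \<in> hom G circle_group"
  shows "group_hom G circle_group \<chi>"
  using assms comm_group_circle_group
  by (simp add: group_hom_def group_hom_axioms_def comm_group_def)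

lemma circle_hom_one:
  assumes "group G" "\<chi> \<in> hom G circle_group"
  shows "\<chi> \<one>\<^bsub>G\<^esub> = 1"
  using group_hom.hom_one[OF group_hom_circle_group[OF assms]] by (simp add: circle_group_def)

text \<open>Translation by \<open>a\<close> permutes the group and multiplies the sum by \<open>\<chi> a \<noteq> 1\<close>.\<close>

lemma sum_nontrivial_character:
  fixes G (structure)
  assumes "group G" "\<chi> \<in> hom G circle_group" "a \<in> carrier G" "\<chi> a \<noteq> 1"
  shows "(\<Sum>x\<in>carrier G. \<chi> x) = 0"
proof -
  interpret group G by fact
  have "(\<Sum>x\<in>carrier G. \<chi> x) = (\<Sum>x\<in>carrier G. \<chi> (a \<otimes> x))"
    by (rule sum.reindex_bij_witness[of _ "\<lambda>x. a \<otimes> x" "\<lambda>x. inv a \<otimes> x"])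
      (use assms in \<open>auto simp: m_assoc[symmetric]\<close>)
  also have "\<dots> = \<chi> a * (\<Sum>x\<in>carrier G. \<chi> x)"
    using assms by (simp add: circle_hom_mult sum_distrib_left)
  finally show ?thesis
    using assms(4) by (simp add: algebra_simps)
qed

text \<open>Equality holds for abelian groups, but the inequality is enough for counting matrices, and it
  needs no structure theory. Let \<open>F\<close> be the sum of all \<open>N\<close> characters. By orthogonality the squared
  norm \<open>\<Sum>x. \<bar>F x\<bar>\<^sup>2\<close> is \<open>N \<cdot> \<bar>G\<bar>\<close>, while its term at the unit alone is \<open>N\<^sup>2\<close>.\<close>

lemma card_character_group_le:
  fixes G (structure)
  assumes "group G" "finite (carrier G)"
  shows "card (carrier (character_group G)) \<le> card (carrier G)"
proof -
  interpret group G by fact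
  let ?D = "carrier (character_group G)"
  define F where "F x = (\<Sum>h\<in>?D. h x)" for x
  define N where "N = card ?D"
  have finD: "finite ?D"
    using assms by (rule finite_character_group)
  have hom: "h \<in> hom G circle_group" if "h \<in> ?D" for h
    using that by (simp add: character_group_def)
  have inner: "(\<Sum>x\<in>carrier G. h x * cnj (k x)) = (if h = k then of_nat (card (carrier G)) else 0)"
    if h: "h \<in> ?D" and k: "k \<in> ?D" for h k
  proof (cases "h = k")
    case True
    have "h x * cnj (h x) = 1" if "x \<in> carrier G" for x
      using circle_hom_norm[OF hom[OF h] that] by (simp flip: complex_norm_square)
    with True show ?thesis by simp
  next
    case False
    let ?\<chi> = "\<lambda>x. h x * cnj (k x)"
    obtain a where a: "a \<in> carrier G" "h a \<noteq> k a"
      using False h k by (auto simp: character_group_def intro: extensionalityI)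
    have "?\<chi> \<in> hom G circle_group"
      using hom[OF h] hom[OF k] by (auto simp: hom_def circle_group_def norm_mult Pi_iff)
    moreover have "?\<chi> a \<noteq> 1"
    proof
      assume "?\<chi> a = 1"
      moreover have "k a * cnj (k a) = 1"
        using circle_hom_norm[OF hom[OF k] a(1)] by (simp flip: complex_norm_square)
      ultimately show False
        using a(2) by (metis mult.commute mult.left_commute mult.right_neutral)
    qed
    ultimately have "(\<Sum>x\<in>carrier G. ?\<chi> x) = 0"
      using sum_nontrivial_character[OF assms(1)] a(1) by blast
    with False show ?thesis by simp
  qed
  have "(\<Sum>x\<in>carrier G. F x * cnj (F x)) = (\<Sum>h\<in>?D. \<Sum>k\<in>?D. \<Sum>x\<in>carrier G. h x * cnj (k x))"
  proof -
    have "(\<Sum>x\<in>carrier G. F x * cnj (F x)) = (\<Sum>x\<in>carrier G. \<Sum>h\<in>?D. \<Sum>k\<in>?D. h x * cnj (k x))"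
      by (simp add: F_def cnj_sum sum_product)
    also have "\<dots> = (\<Sum>h\<in>?D. \<Sum>x\<in>carrier G. \<Sum>k\<in>?D. h x * cnj (k x))"
      by (rule sum.swap)
    also have "\<dots> = (\<Sum>h\<in>?D. \<Sum>k\<in>?D. \<Sum>x\<in>carrier G. h x * cnj (k x))"
      by (intro sum.cong refl sum.swap)
    finally show ?thesis .
  qed
  also have "\<dots> = of_nat (N * card (carrier G))"
    using finD by (simp add: inner N_def)
  finally have "complex_of_real (\<Sum>x\<in>carrier G. (cmod (F x))\<^sup>2) = of_real (real (N * card (carrier G)))"
    by (simp only: of_real_sum complex_norm_square of_real_of_nat_eq)
  then have sumF: "(\<Sum>x\<in>carrier G. (cmod (F x))\<^sup>2) = real (N * card (carrier G))"
    by (simp only: of_real_eq_iff)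
  have "F \<one> = of_nat N"
    by (simp add: F_def N_def circle_hom_one[OF assms(1) hom])
  then have "real (N * N) = (cmod (F \<one>))\<^sup>2"
    by (simp add: power2_eq_square)
  also have "\<dots> \<le> (\<Sum>x\<in>carrier G. (cmod (F x))\<^sup>2)"
    using assms(2) by (intro member_le_sum) auto
  finally have "N * N \<le> N * card (carrier G)"
    unfolding sumF by (simp only: of_nat_le_iff)
  then show ?thesis
    by (cases "N = 0") (auto simp: N_def)
qed

section \<open>Small subgroups on which prescribed characters are nontrivial\<close>

text \<open>The kernel is a proper subgroup, so its index is a divisor of the order different from 1 and
  has a prime factor, which is at least \<open>p\<close>.\<close>

lemma card_character_kernel_le:
  fixes G (structure)
  assumes "group G" "finite (carrier G)" "\<chi> \<in> hom G circle_group"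
    and "a \<in> carrier G" "\<chi> a \<noteq> 1"
    and p: "\<And>q. prime q \<Longrightarrow> q dvd order G \<Longrightarrow> p \<le> q"
  shows "p * card {x \<in> carrier G. \<chi> x = 1} \<le> card (carrier G)"
proof -
  interpret group_hom G circle_group \<chi>
    using assms(1,3) by (rule group_hom_circle_group)
  let ?K = "{x \<in> carrier G. \<chi> x = 1}"
  have "?K = kernel G circle_group \<chi>"
    by (auto simp: kernel_def circle_group_def)
  then have sub: "subgroup ?K G"
    using subgroup_kernel by simp
  have lag: "card (rcosets ?K) * card ?K = order G"
    by (rule G.lagrange[OF sub])
  have "card ?K < order G"
    unfolding order_def using assms by (intro psubset_card_mono) auto
  then have "card (rcosets ?K) \<noteq> 1"
    using lag by auto
  then obtain q where q: "prime q" "q dvd card (rcosets ?K)"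
    using prime_factor_nat by blast
  have "card (rcosets ?K) \<noteq> 0"
    using lag \<open>card ?K < order G\<close> by (intro notI) simp
  then have "q \<le> card (rcosets ?K)"
    using dvd_imp_le[OF q(2)] by simp
  moreover have "p \<le> q"
  proof (rule p[OF q(1)])
    show "q dvd order G"
      unfolding lag[symmetric] using q(2) by (rule dvd_mult2)
  qed
  ultimately have "p * card ?K \<le> card (rcosets ?K) * card ?K"
    by (intro mult_le_mono1) (rule le_trans)
  then show ?thesis
    by (simp only: lag order_def)
qed

text \<open>Counting the pairs \<open>(x, \<chi>)\<close> with \<open>\<chi> x = 1\<close> in two ways shows that an average element \<open>x\<close> is in
  the kernel of at most a fraction \<open>1/p\<close> of the characters.\<close>

lemma exists_element_few_trivial:
  fixes G (structure)
  assumes "group G" "finite (carrier G)" "finite S" "S \<subseteq> hom G circle_group"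
    and nontriv: "\<And>\<chi>. \<chi> \<in> S \<Longrightarrow> \<exists>a\<in>carrier G. \<chi> a \<noteq> 1"
    and p: "\<And>q. prime q \<Longrightarrow> q dvd order G \<Longrightarrow> p \<le> q"
  shows "\<exists>x\<in>carrier G. p * card {\<chi> \<in> S. \<chi> x = 1} \<le> card S"
proof (rule ccontr)
  assume "\<not> ?thesis"
  then have less: "card S < p * card {\<chi> \<in> S. \<chi> x = 1}" if "x \<in> carrier G" for x
    using that by auto
  interpret group G by fact
  have "card (carrier G) * card S = (\<Sum>x\<in>carrier G. card S)"
    by simp
  also have "\<dots> < (\<Sum>x\<in>carrier G. p * card {\<chi> \<in> S. \<chi> x = 1})"
    using assms(2) less by (intro sum_strict_mono) auto
  also have "\<dots> = p * (\<Sum>x\<in>carrier G. card {\<chi> \<in> S. \<chi> x = 1})"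
    by (simp add: sum_distrib_left)
  also have "(\<Sum>x\<in>carrier G. card {\<chi> \<in> S. \<chi> x = 1})
      = (\<Sum>\<chi>\<in>S. card {x \<in> carrier G. \<chi> x = 1})"
    using assms(2,3) by (intro sum_multicount_gen) auto
  also have "p * \<dots> = (\<Sum>\<chi>\<in>S. p * card {x \<in> carrier G. \<chi> x = 1})"
    by (simp add: sum_distrib_left)
  also have "\<dots> \<le> (\<Sum>\<chi>\<in>S. card (carrier G))"
  proof (rule sum_mono)
    fix \<chi> assume "\<chi> \<in> S"
    then obtain a where "a \<in> carrier G" "\<chi> a \<noteq> 1" "\<chi> \<in> hom G circle_group"
      using nontriv assms(4) by blast
    then show "p * card {x \<in> carrier G. \<chi> x = 1} \<le> card (carrier G)"
      using card_character_kernel_le[OF assms(1,2)] p by blast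
  qed
  finally show False
    by (simp add: mult.commute)
qed

text \<open>Each step of the induction enlarges the subgroup by the cyclic group of an element as in
  \<open>exists_element_few_trivial\<close>. This costs a factor of at most \<open>e\<close> in the size of the subgroup and
  divides by \<open>p\<close> the number of characters that are still trivial on it.\<close>

lemma exists_small_subgroup_detecting:
  fixes G (structure)
  assumes "comm_group G" "finite (carrier G)"
    and e: "e > 0" "\<And>x. x \<in> carrier G \<Longrightarrow> x [^] (e::nat) = \<one>"
    and p: "p > 0" "\<And>q. prime q \<Longrightarrow> q dvd order G \<Longrightarrow> p \<le> q"
    and "finite S" "S \<subseteq> hom G circle_group"
    and "\<And>\<chi>. \<chi> \<in> S \<Longrightarrow> \<exists>a\<in>carrier G. \<chi> a \<noteq> 1"
    and "card S < p ^ d"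
  shows "\<exists>P. subgroup P G \<and> card P \<le> e ^ d \<and> (\<forall>\<chi>\<in>S. \<exists>x\<in>P. \<chi> x \<noteq> 1)"
proof -
  interpret comm_group G by fact
  show ?thesis
    using assms(7-10)
  proof (induction d arbitrary: S)
    case 0
    then have "S = {}" by simp
    then show ?case
      using triv_subgroup by (intro exI[of _ "{\<one>}"]) auto
  next
    case (Suc d)
    obtain x where x: "x \<in> carrier G" and few: "p * card {\<chi> \<in> S. \<chi> x = 1} \<le> card S"
      using exists_element_few_trivial[OF is_group assms(2) Suc.prems(1-3) p(2)] by blast
    define S' where "S' = {\<chi> \<in> S. \<chi> x = 1}"
    have "p * card S' < p * p ^ d"
      unfolding S'_def power_Suc[symmetric] using few Suc.prems(4) by (rule le_less_trans)
    then have "card S' < p ^ d"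
      by (rule mult_left_less_imp_less) simp
    then obtain P where P: "subgroup P G" "card P \<le> e ^ d" "\<And>\<chi>. \<chi> \<in> S' \<Longrightarrow> \<exists>y\<in>P. \<chi> y \<noteq> 1"
      using Suc.IH[of S'] Suc.prems(1-3) by (auto simp: S'_def)
    define C where "C = generate G {x}"
    have C: "subgroup C G" "x \<in> C"
      using x by (auto simp: C_def intro: generate_is_subgroup generate.incl)
    have "ord x dvd e"
      using e(2)[OF x] pow_eq_id[OF x] by simp
    then have cardC: "card C \<le> e"
      using e(1) generate_pow_card[OF x] by (simp add: C_def dvd_imp_le)
    have fin: "finite P" "finite C"
      using P(1) C(1) assms(2) by (auto dest!: subgroup.subset intro: finite_subset)
    have "P <#> C = (\<lambda>(y, z). y \<otimes> z) ` (P \<times> C)"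
      by (auto simp: set_mult_def)
    then have "card (P <#> C) \<le> card P * card C"
      using card_image_le[of "P \<times> C" "\<lambda>(y, z). y \<otimes> z"] fin by (simp add: card_cartesian_product)
    also have "\<dots> \<le> e ^ d * e"
      using P(2) cardC by (rule mult_le_mono)
    finally have card: "card (P <#> C) \<le> e ^ Suc d"
      by (simp add: mult.commute)
    have "y \<otimes> \<one> \<in> P <#> C" if "y \<in> P" for y
      using that subgroup.one_closed[OF C(1)] by (auto simp: set_mult_def)
    then have PC: "P \<subseteq> P <#> C"
      using P(1) subgroup.mem_carrier by fastforce
    have "\<one> \<otimes> x \<in> P <#> C"
      using C(2) subgroup.one_closed[OF P(1)] by (auto simp: set_mult_def)
    then have xPC: "x \<in> P <#> C"
      using x by simp
    have "\<exists>y\<in>P <#> C. \<chi> y \<noteq> 1" if "\<chi> \<in> S" for \<chi>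
      using that P(3)[of \<chi>] PC xPC by (cases "\<chi> x = 1") (auto simp: S'_def)
    then show ?case
      using mult_subgroups[OF P(1) C(1)] card by blast
  qed
qed

section \<open>Matrices over the group and its dual\<close>

lemma comm_group_matrix_group:
  assumes "comm_group G"
  shows "comm_group (matrix_group s n G)"
proof -
  have "group (matrix_group s n G)"
    using assms by (simp add: matrix_group_def comm_group_def)
  then show ?thesis
    by (rule group.group_comm_groupI)
      (use assms in \<open>auto simp: matrix_group_def PiE_iff comm_group_def comm_monoid.m_comm
        intro!: restrict_ext\<close>)
qed

lemma matrix_group_pow:
  assumes "group G" "x \<in> carrier (matrix_group s n G)"
  shows "x [^]\<^bsub>matrix_group s n G\<^esub> (k::nat) = (\<lambda>ij\<in>{1..s} \<times> {1..n}. x ij [^]\<^bsub>G\<^esub> k)"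
  using assms(2)
  by (induction k) (auto simp: matrix_group_def nat_pow_def intro!: restrict_ext)

lemma matrix_group_pow_card:
  assumes "group G" "x \<in> carrier (matrix_group s n G)"
  shows "x [^]\<^bsub>matrix_group s n G\<^esub> card (carrier G) = \<one>\<^bsub>matrix_group s n G\<^esub>"
  unfolding matrix_group_pow[OF assms]
  using assms group.pow_order_eq_1[OF assms(1)]
  by (auto simp: matrix_group_def order_def PiE_iff intro!: restrict_ext)

lemma order_matrix_group: "order (matrix_group s n G) = card (carrier G) ^ (s * n)"
  by (simp add: order_def matrix_group_def card_PiE card_cartesian_product)

lemma matrix_pairing_hom:
  assumes "A \<in> carrier (matrix_group s n (character_group G))"
  shows "matrix_pairing s n A \<in> hom (matrix_group s n G) circle_group"
proof -
  have hom: "A (i, j) \<in> hom G circle_group" if "i \<in> {1..s}" "j \<in> {1..n}" for i j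
  proof -
    have "A (i, j) \<in> carrier (character_group G)"
      using assms that by (auto simp: matrix_group_def PiE_iff)
    then show ?thesis
      by (simp add: character_group_def)
  qed
  have mem: "B (i, j) \<in> carrier G"
    if "B \<in> carrier (matrix_group s n G)" "i \<in> {1..s}" "j \<in> {1..n}" for B i j
    using that by (auto simp: matrix_group_def PiE_iff)
  show ?thesis
  proof (rule homI)
    fix B assume "B \<in> carrier (matrix_group s n G)"
    then show "matrix_pairing s n A B \<in> carrier circle_group"
      using circle_hom_norm[OF hom mem]
      by (simp add: matrix_pairing_def circle_group_def flip: prod_norm)
  next
    fix B B' assume B: "B \<in> carrier (matrix_group s n G)" "B' \<in> carrier (matrix_group s n G)"
    have "matrix_pairing s n A (B \<otimes>\<^bsub>matrix_group s n G\<^esub> B') =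
        (\<Prod>i = 1..s. \<Prod>j = 1..n. A (i, j) (B (i, j)) * A (i, j) (B' (i, j)))"
      unfolding matrix_pairing_def
      using circle_hom_mult[OF hom mem[OF B(1)] mem[OF B(2)]]
      by (intro prod.cong refl) (auto simp: matrix_group_def)
    then show "matrix_pairing s n A (B \<otimes>\<^bsub>matrix_group s n G\<^esub> B')
        = matrix_pairing s n A B \<otimes>\<^bsub>circle_group\<^esub> matrix_pairing s n A B'"
      by (simp add: matrix_pairing_def circle_group_def prod.distrib)
  qed
qed

text \<open>If the entry \<open>A (i, j)\<close> is not the trivial character, a matrix \<open>B\<close> supported at the position
  \<open>(i, j)\<close> detects it.\<close>

lemma matrix_pairing_nontrivial:
  assumes "group G" "A \<in> carrier (matrix_group s n (character_group G))"
    and "A \<noteq> \<one>\<^bsub>matrix_group s n (character_group G)\<^esub>"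
  shows "\<exists>B\<in>carrier (matrix_group s n G). matrix_pairing s n A B \<noteq> 1"
proof -
  let ?I = "{1..s} \<times> {1..n}"
  have A: "A ij \<in> carrier (character_group G)" if "ij \<in> ?I" for ij
    using assms(2) that by (cases ij) (auto simp: matrix_group_def PiE_iff)
  obtain i j where ij: "i \<in> {1..s}" "j \<in> {1..n}" "A (i, j) \<noteq> \<one>\<^bsub>character_group G\<^esub>"
  proof -
    have "\<exists>ij\<in>?I. A ij \<noteq> \<one>\<^bsub>character_group G\<^esub>"
    proof (rule ccontr)
      assume "\<not> ?thesis"
      then have "A = (\<lambda>ij\<in>?I. \<one>\<^bsub>character_group G\<^esub>)"
        using assms(2) by (intro extensionalityI[of _ ?I]) (auto simp: matrix_group_def PiE_iff)
      then show False
        using assms(3) by (simp add: matrix_group_def)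
    qed
    then show thesis
      using that by auto
  qed
  have one: "h \<one>\<^bsub>G\<^esub> = 1" if "h \<in> carrier (character_group G)" for h
    using that circle_hom_one[OF assms(1)] by (simp add: character_group_def)
  obtain g where g: "g \<in> carrier G" "A (i, j) g \<noteq> 1"
  proof -
    have "\<exists>g\<in>carrier G. A (i, j) g \<noteq> 1"
    proof (rule ccontr)
      assume *: "\<not> ?thesis"
      have "A (i, j) = (\<lambda>g\<in>carrier G. 1)"
        using A[of "(i, j)"] ij(1,2) *
        by (intro extensionalityI[of _ "carrier G"]) (auto simp: character_group_def)
      then show False
        using ij(3) by (simp add: character_group_def)
    qed
    then show thesis
      using that by auto
  qed
  define B where "B = (\<lambda>kl\<in>?I. if kl = (i, j) then g else \<one>\<^bsub>G\<^esub>)"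
  have "B \<in> carrier (matrix_group s n G)"
    using g(1) group.is_monoid[OF assms(1)] by (auto simp: B_def matrix_group_def PiE_iff)
  moreover have "matrix_pairing s n A B = A (i, j) g"
  proof -
    have "matrix_pairing s n A B = (\<Prod>kl\<in>?I. A kl (B kl))"
      by (simp add: matrix_pairing_def prod.cartesian_product)
    also have "\<dots> = (\<Prod>kl\<in>?I. if kl = (i, j) then A (i, j) g else 1)"
      using one[OF A] by (intro prod.cong) (auto simp: B_def)
    also have "\<dots> = A (i, j) g"
      using ij(1,2) by (subst prod.delta) auto
    finally show ?thesis .
  qed
  ultimately show ?thesis
    using g(2) by (intro bexI[of _ B]) simp_all
qed

lemma prime_smallest_prime_factor:
  assumes "b \<ge> 2"
  shows "prime (smallest_prime_factor b)"
proof -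
  have "\<exists>q. prime q \<and> q dvd b"
    using assms prime_factor_nat[of b] by auto
  then have "smallest_prime_factor b \<in> prime_factors b"
    unfolding smallest_prime_factor_def
    using assms by (intro Min_in) (auto simp: prime_factors_dvd)
  then show ?thesis
    by (simp add: in_prime_factors_iff)
qed

text \<open>The characters to be detected are the pairings with the nonzero matrices of weight at most \<open>m\<close>.
  The zero matrix is always counted in \<open>few\<close>, which is why the weak inequality there yields the strict
  one that \<open>exists_small_subgroup_detecting\<close> asks for.\<close>

lemma exists_subgroup_large_min_weight:
  fixes G (structure)
  assumes "comm_group G" "finite (carrier G)" "card (carrier G) = b" "b \<ge> 2"
    and few: "card {A \<in> carrier (matrix_group s n (character_group G)). dick_weight G s n A \<le> m}
      \<le> smallest_prime_factor b ^ d"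
  shows "\<exists>P. subgroup P (matrix_group s n G) \<and> card P \<le> b ^ d \<and>
    (\<forall>A\<in>perp G s n P - {\<one>\<^bsub>matrix_group s n (character_group G)\<^esub>}. m < dick_weight G s n A)"
proof -
  interpret comm_group G by fact
  let ?M = "matrix_group s n G" and ?D = "matrix_group s n (character_group G)"
  let ?p = "smallest_prime_factor b"
  define L where "L = {A \<in> carrier ?D. dick_weight G s n A \<le> m}"
  define S where "S = matrix_pairing s n ` (L - {\<one>\<^bsub>?D\<^esub>})"
  have "finite (carrier ?D)"
    using finite_character_group[OF is_group assms(2)]
    by (auto simp: matrix_group_def intro!: finite_PiE)
  then have finL: "finite L"
    by (simp add: L_def)
  have "group (character_group G)"
    using comm_group_character_group[OF is_group] by (simp add: comm_group_def)
  then have "group ?D"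
    by (simp add: matrix_group_def)
  then have "\<one>\<^bsub>?D\<^esub> \<in> carrier ?D"
    by (simp add: group.is_monoid)
  moreover have "dick_weight G s n \<one>\<^bsub>?D\<^esub> = 0"
    by (simp add: dick_weight_def matrix_group_def)
  ultimately have "\<one>\<^bsub>?D\<^esub> \<in> L"
    by (simp add: L_def)
  have "card S \<le> card (L - {\<one>\<^bsub>?D\<^esub>})"
    unfolding S_def using finL by (intro card_image_le) auto
  also have "\<dots> < card L"
    using finL \<open>\<one>\<^bsub>?D\<^esub> \<in> L\<close> by (rule card_Diff1_less)
  also have "\<dots> \<le> ?p ^ d"
    using few by (simp add: L_def)
  finally have cardS: "card S < ?p ^ d" .
  have p_le: "?p \<le> q" if "prime q" "q dvd b" for q
    unfolding smallest_prime_factor_def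
    using that assms(4) by (intro Min_le) (auto simp: prime_factors_dvd)
  have p_pos: "?p > 0"
    using prime_smallest_prime_factor[OF assms(4)] by (rule prime_gt_0_nat)
  have finM: "finite (carrier ?M)"
    using assms(2) by (auto simp: matrix_group_def intro!: finite_PiE)
  have "\<exists>P. subgroup P ?M \<and> card P \<le> b ^ d \<and> (\<forall>\<chi>\<in>S. \<exists>x\<in>P. \<chi> x \<noteq> 1)"
  proof (rule exists_small_subgroup_detecting[OF comm_group_matrix_group[OF assms(1)] finM])
    show "b > 0" using assms(4) by simp
    show "x [^]\<^bsub>?M\<^esub> b = \<one>\<^bsub>?M\<^esub>" if "x \<in> carrier ?M" for x
      using matrix_group_pow_card[OF is_group that] assms(3) by simp
    show "?p > 0" by (fact p_pos)
    show "?p \<le> q" if "prime q" "q dvd order ?M" for q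
      using that p_le assms(3) by (metis order_matrix_group prime_dvd_power)
    show "finite S" using finL by (simp add: S_def)
    show "S \<subseteq> hom ?M circle_group"
      using matrix_pairing_hom by (auto simp: S_def L_def)
    show "\<exists>a\<in>carrier ?M. \<chi> a \<noteq> 1" if "\<chi> \<in> S" for \<chi>
      using that matrix_pairing_nontrivial[OF is_group] by (auto simp: S_def L_def)
    show "card S < ?p ^ d" by (fact cardS)
  qed
  then obtain P where P: "subgroup P ?M" "card P \<le> b ^ d" "\<And>\<chi>. \<chi> \<in> S \<Longrightarrow> \<exists>x\<in>P. \<chi> x \<noteq> 1"
    by blast
  have "m < dick_weight G s n A" if "A \<in> perp G s n P - {\<one>\<^bsub>?D\<^esub>}" for A
  proof (rule ccontr)
    assume "\<not> ?thesis"
    then have "matrix_pairing s n A \<in> S"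
      using that by (auto simp: S_def L_def perp_def)
    then obtain x where "x \<in> P" "matrix_pairing s n A x \<noteq> 1"
      using P(3) by blast
    then show False
      using that by (auto simp: perp_def)
  qed
  then show ?thesis
    using P(1,2) by blast
qed

section \<open>Counting matrices of small weight\<close>

text \<open>The full series has the value \<open>1 / (exp u - 1)\<close>, and \<open>exp u - 1 \<ge> u\<close>.\<close>

lemma sum_exp_neg_powers_le:
  fixes u :: real
  assumes "u > 0"
  shows "(\<Sum>j = 1..n. exp (- u) ^ j) \<le> 1 / u"
proof -
  define z where "z = exp (- u)"
  have z: "0 < z" "z < 1"
    using assms by (auto simp: z_def)
  have "(1 + u) * z \<le> exp u * z"
    using exp_ge_add_one_self[of u] z by (intro mult_right_mono) auto
  also have "\<dots> = 1"
    by (simp add: z_def flip: exp_add)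
  finally have "z / (1 - z) \<le> 1 / u"
    using z assms by (simp add: field_simps)
  moreover have "(\<Sum>j = 1..n. z ^ j) \<le> z / (1 - z)"
  proof -
    have "(\<Sum>j = 1..n. z ^ j) = z * (\<Sum>j<n. z ^ j)"
      by (simp add: sum_distrib_left sum.atLeast1_atMost_eq)
    also have "\<dots> = z * ((1 - z ^ n) / (1 - z))"
      using z by (simp add: sum_gp_strict)
    also have "\<dots> \<le> z * (1 / (1 - z))"
      using z by (intro mult_left_mono divide_right_mono) auto
    finally show ?thesis by simp
  qed
  ultimately show ?thesis
    by (simp add: z_def)
qed

text \<open>The weight is a sum over the entries, so its generating function factors into one factor
  \<open>1 + (\<bar>D\<bar> - 1) z\<^sup>j\<close> for each entry of column \<open>j\<close>; then \<open>1 + x \<le> exp x\<close>.\<close>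

lemma weight_generating_function_le:
  fixes z :: real
  assumes "finite D" "e \<in> D" "0 < z"
  shows "(\<Sum>A\<in>({1..s} \<times> {1..n} \<rightarrow>\<^sub>E D).
      z ^ (\<Sum>i = 1..s. \<Sum>j = 1..n. j * (if A (i, j) = e then 0 else 1)))
    \<le> exp ((real (card D) - 1) * real s * (\<Sum>j = 1..n. z ^ j))"
    (is "sum ?w _ \<le> _")
proof -
  let ?I = "{1..s} \<times> {1..n}"
  have "sum ?w (?I \<rightarrow>\<^sub>E D)
      = (\<Sum>A\<in>?I \<rightarrow>\<^sub>E D. \<Prod>ij\<in>?I. z ^ (snd ij * (if A ij = e then 0 else 1)))"
    by (simp add: sum.cartesian_product power_sum case_prod_unfold)
  also have "\<dots> = (\<Prod>ij\<in>?I. \<Sum>h\<in>D. z ^ (snd ij * (if h = e then 0 else 1)))"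
    using assms(1) by (subst prod_sum_PiE) auto
  also have "\<dots> = (\<Prod>ij\<in>?I. 1 + (real (card D) - 1) * z ^ snd ij)"
  proof (rule prod.cong[OF refl])
    fix ij :: "nat \<times> nat"
    have "card D > 0"
      using assms(1,2) by (auto simp: card_gt_0_iff)
    moreover have "(\<Sum>h\<in>D. z ^ (snd ij * (if h = e then 0 else 1))) = 1 + (\<Sum>h\<in>D - {e}. z ^ snd ij)"
      using assms(1,2) by (subst sum.remove[of _ e]) auto
    ultimately show "(\<Sum>h\<in>D. z ^ (snd ij * (if h = e then 0 else 1)))
        = 1 + (real (card D) - 1) * z ^ snd ij"
      using assms(1,2) by (simp add: of_nat_diff)
  qed
  also have "\<dots> \<le> (\<Prod>ij\<in>?I. exp ((real (card D) - 1) * z ^ snd ij))"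
  proof (rule prod_mono)
    fix ij :: "nat \<times> nat"
    have "card D > 0"
      using assms(1,2) by (auto simp: card_gt_0_iff)
    then have "(real (card D) - 1) * z ^ snd ij \<ge> 0"
      using assms(3) by (intro mult_nonneg_nonneg) auto
    then show "0 \<le> 1 + (real (card D) - 1) * z ^ snd ij \<and>
        1 + (real (card D) - 1) * z ^ snd ij \<le> exp ((real (card D) - 1) * z ^ snd ij)"
      by auto
  qed
  also have "\<dots> = exp (\<Sum>ij\<in>?I. (real (card D) - 1) * z ^ snd ij)"
    by (simp add: exp_sum)
  also have "(\<Sum>ij\<in>?I. (real (card D) - 1) * z ^ snd ij)
      = (\<Sum>i = 1..s. \<Sum>j = 1..n. (real (card D) - 1) * z ^ j)"
    unfolding sum.cartesian_product by (simp add: case_prod_unfold)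
  also have "\<dots> = (real (card D) - 1) * real s * (\<Sum>j = 1..n. z ^ j)"
    by (simp add: sum_distrib_left mult_ac)
  finally show ?thesis .
qed

text \<open>For \<open>0 < z < 1\<close>, each matrix of weight at most \<open>m\<close> contributes at least \<open>z\<^sup>m\<close> to the generating
  function. With \<open>z = exp (- u)\<close> and \<open>\<Sum>\<^sub>j z\<^sup>j \<le> 1 / u\<close> this bounds their number by \<open>exp (u m + C / u)\<close>.\<close>

lemma card_weight_le:
  fixes C :: real
  assumes "finite D" "e \<in> D" "C > 0" "(real (card D) - 1) * real s \<le> C"
  shows "real (card {A \<in> {1..s} \<times> {1..n} \<rightarrow>\<^sub>E D.
      (\<Sum>i = 1..s. \<Sum>j = 1..n. j * (if A (i, j) = e then 0 else 1)) \<le> m})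
    \<le> exp (2 * sqrt (C * real m))"
    (is "real (card {A \<in> ?X. ?\<mu> A \<le> m}) \<le> _")
proof (cases "m = 0")
  case True
  \<comment> \<open>There is no optimal \<open>u\<close> here; column indices start at 1, so only the zero matrix has weight 0.\<close>
  have sub: "{A \<in> ?X. ?\<mu> A \<le> m} \<subseteq> {\<lambda>ij\<in>{1..s} \<times> {1..n}. e}"
  proof
    fix A assume "A \<in> {A \<in> ?X. ?\<mu> A \<le> m}"
    then have A: "A \<in> ?X" "?\<mu> A \<le> m"
      by auto
    then have "A (i, j) = e" if "i \<in> {1..s}" "j \<in> {1..n}" for i j
      using True that by (auto split: if_splits)
    then have "A = (\<lambda>ij\<in>{1..s} \<times> {1..n}. e)"
      using A(1) by (intro extensionalityI[of _ "{1..s} \<times> {1..n}"]) (auto simp: PiE_iff)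
    then show "A \<in> {\<lambda>ij\<in>{1..s} \<times> {1..n}. e}"
      by simp
  qed
  have "card {A \<in> ?X. ?\<mu> A \<le> m} \<le> 1"
    using card_mono[OF _ sub] by simp
  then show ?thesis
    using True by simp
next
  case False
  define w where "w = sqrt (C * real m)"
  \<comment> \<open>The minimiser of \<open>u m + C / u\<close>, at which both summands equal \<open>w\<close>.\<close>
  define u where "u = w / real m"
  have w: "w > 0" "w * w = C * real m"
    using assms(3) False by (auto simp: w_def)
  have u: "u > 0" "u * real m = w" "C / u = w"
    using w False by (auto simp: u_def field_simps)
  have finX: "finite ?X"
    using assms(1) by (intro finite_PiE) auto
  have "exp (- u) ^ m * real (card {A \<in> ?X. ?\<mu> A \<le> m}) = (\<Sum>A\<in>{A \<in> ?X. ?\<mu> A \<le> m}. exp (- u) ^ m)"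
    by simp
  also have "\<dots> \<le> (\<Sum>A\<in>{A \<in> ?X. ?\<mu> A \<le> m}. exp (- u) ^ ?\<mu> A)"
    using u(1) by (intro sum_mono power_decreasing) auto
  also have "\<dots> \<le> (\<Sum>A\<in>?X. exp (- u) ^ ?\<mu> A)"
    using finX by (intro sum_mono2) auto
  also have "\<dots> \<le> exp ((real (card D) - 1) * real s * (\<Sum>j = 1..n. exp (- u) ^ j))"
    using assms(1,2) by (intro weight_generating_function_le) auto
  also have "\<dots> \<le> exp (C * (1 / u))"
    using assms(3,4) sum_exp_neg_powers_le[OF u(1), of n]
    by (intro iffD2[OF exp_le_cancel_iff] mult_mono) (auto intro!: sum_nonneg)
  also have "\<dots> = exp w"
    using u(3) by simp
  finally have "exp (- w) * real (card {A \<in> ?X. ?\<mu> A \<le> m}) \<le> exp w"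
    using u(2) by (simp add: mult.commute flip: exp_of_nat_mult)
  then have "real (card {A \<in> ?X. ?\<mu> A \<le> m}) \<le> exp w * exp w"
    by (simp add: exp_minus field_simps)
  then show ?thesis
    by (simp add: w_def flip: exp_add)
qed

lemma card_dick_weight_le:
  fixes G (structure)
  assumes "group G" "finite (carrier G)" "card (carrier G) = b" "b \<ge> 2" "s > 0"
  shows "real (card {A \<in> carrier (matrix_group s n (character_group G)). dick_weight G s n A \<le> m})
    \<le> exp (2 * sqrt ((real b - 1) * real s * real m))"
proof -
  interpret D: comm_group "character_group G"
    using assms(1) by (rule comm_group_character_group)
  have "real (card (carrier (character_group G))) - 1 \<le> real b - 1"
    using card_character_group_le[OF assms(1,2)] assms(3) by simp
  then show ?thesis
    using card_weight_le[OF finite_character_group[OF assms(1,2)] D.one_closed,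
        of "(real b - 1) * real s" s n m] assms(4,5)
    by (simp add: matrix_group_def dick_weight_def mult_right_mono)
qed

section \<open>The tail of the figure of merit\<close>

lemma sum_over_tail_le:
  fixes f :: "nat \<Rightarrow> real"
  assumes "finite Q" "\<And>A. A \<in> Q \<Longrightarrow> m < \<mu> A"
    and "\<And>k. f k \<ge> 0" "0 < q" "q < 1" "E \<ge> 0"
    and level: "\<And>j. real (card {A \<in> Q. \<mu> A = Suc m + j}) * f (Suc m + j) \<le> E * q ^ j"
  shows "(\<Sum>A\<in>Q. f (\<mu> A)) \<le> E / (1 - q)"
proof -
  obtain N where N: "\<And>A. A \<in> Q \<Longrightarrow> \<mu> A < Suc m + N"
  proof -
    have "\<mu> A < Suc m + Suc (Max (\<mu> ` Q))" if "A \<in> Q" for A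
      using Max_ge[of "\<mu> ` Q" "\<mu> A"] assms(1) that
      by (metis add_Suc finite_imageI image_eqI le_imp_less_Suc le_add2 le_trans add_Suc_right)
    then show thesis
      using that by blast
  qed
  have "(\<Sum>A\<in>Q. f (\<mu> A)) = (\<Sum>j<N. \<Sum>A\<in>{A \<in> Q. \<mu> A - Suc m = j}. f (\<mu> A))"
    using assms(1,2) N by (intro sum.group[symmetric]) force+
  also have "\<dots> = (\<Sum>j<N. real (card {A \<in> Q. \<mu> A = Suc m + j}) * f (Suc m + j))"
  proof (rule sum.cong[OF refl])
    fix j
    have "{A \<in> Q. \<mu> A - Suc m = j} = {A \<in> Q. \<mu> A = Suc m + j}"
      using assms(2) by force
    then show "(\<Sum>A\<in>{A \<in> Q. \<mu> A - Suc m = j}. f (\<mu> A))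
        = real (card {A \<in> Q. \<mu> A = Suc m + j}) * f (Suc m + j)"
      by simp
  qed
  also have "\<dots> \<le> (\<Sum>j<N. E * q ^ j)"
    by (intro sum_mono level)
  also have "\<dots> = E * ((1 - q ^ N) / (1 - q))"
    using assms(5) by (simp add: sum_gp_strict flip: sum_distrib_left)
  also have "\<dots> \<le> E * (1 / (1 - q))"
    using assms by (intro mult_left_mono divide_right_mono) auto
  finally show ?thesis
    by simp
qed

text \<open>The concave function \<open>2 sqrt (C k)\<close> of \<open>k\<close> lies below its tangent at \<open>y\<^sup>2 / C\<close>, whose slope \<open>C / y\<close> is
  at most \<open>L / (1 + c)\<close>. So subtracting \<open>k L\<close> leaves a decrease of at least \<open>c L / (1 + c)\<close> per unit.\<close>

lemma two_sqrt_minus_linear_le: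
  fixes C L y k c j :: real
  assumes "C > 0" "y > 0" "c > 0" "L > 0" "(1 + c) * C \<le> y * L"
    and "k \<ge> 0" "j \<ge> 0" "k - y\<^sup>2 / C \<ge> j"
  shows "2 * sqrt (C * k) - k * L \<le> 2 * y - y\<^sup>2 / C * L - c * L / (1 + c) * j"
proof -
  define X r where "X = y\<^sup>2 / C" and "r = C / y"
  have rX: "r * X = y"
    using assms(1,2) by (simp add: X_def r_def power2_eq_square)
  \<comment> \<open>The tangent bound is the inequality between the geometric and the arithmetic mean.\<close>
  have "sqrt (C * k) = sqrt (y * (r * k))"
    using assms(2) by (simp add: r_def)
  also have "\<dots> \<le> (y + r * k) / 2"
    using assms by (intro arith_geo_mean_sqrt) (auto simp: r_def)
  finally have *: "2 * sqrt (C * k) - k * L \<le> 2 * y - X * L - (L - r) * (k - X)"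
    using rX by (simp add: algebra_simps)
  have "r \<le> L / (1 + c)"
    using assms(2,3,5) by (simp add: r_def field_simps)
  moreover have "L - L / (1 + c) = c * L / (1 + c)"
    using assms(3) by (simp add: field_simps)
  ultimately have rate: "c * L / (1 + c) \<le> L - r"
    by linarith
  have slope: "c * L / (1 + c) * j \<le> (L - r) * (k - X)"
  proof (rule mult_mono[OF rate])
    show "0 \<le> L - r"
      using assms(3,4) by (intro order_trans[OF _ rate]) auto
  qed (use assms(7,8) in \<open>auto simp: X_def\<close>)
  show ?thesis
    unfolding X_def[symmetric] by (rule order_trans[OF * diff_left_mono[OF slope]])
qed

lemma inverse_one_minus_exp_le:
  fixes t :: real
  assumes "t > 0"
  shows "1 / (1 - exp (- t)) \<le> 1 + 1 / t"
proof -
  have "(1 + t) * exp (- t) \<le> exp t * exp (- t)"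
    using exp_ge_add_one_self[of t] by (intro mult_right_mono) auto
  then have "(1 + t) * exp (- t) \<le> 1"
    by (simp flip: exp_add)
  moreover have "exp (- t) < 1"
    using assms by simp
  ultimately show ?thesis
    using assms by (simp add: field_simps)
qed

theorem theorem5p13:
  fixes G :: "('a, 'm) monoid_scheme" and b :: nat and c :: real and s n d :: nat
  assumes "comm_group G" and "finite (carrier G)"
    and "card (carrier G) = b" and "b \<ge> 2"
    and "c > 0"
    and "s > 0" and "n > 0" and "d > 0"
    and "real d \<ge> (1 + c) * (real b - 1) * real s / (wafom_alpha b * ln (real b))"
  shows "\<exists>P. subgroup P (matrix_group s n G) \<and> card P \<le> b ^ d \<and>
           wafom G s n P \<le>
             (1 + (1 + c) / c * (1 / ln (real b)))
               * real b powr (- ((wafom_alpha b)\<^sup>2 * (real d)\<^sup>2 / ((real b - 1) * real s)))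
               * exp (2 * wafom_alpha b * real d)"
proof -
  interpret comm_group G by fact
  let ?D = "matrix_group s n (character_group G)"
  define C where "C = (real b - 1) * real s"
  define L where "L = ln (real b)"
  define y where "y = wafom_alpha b * real d"
  define X where "X = y\<^sup>2 / C"
  define m where "m = nat \<lfloor>X\<rfloor>"
  define t where "t = c * L / (1 + c)"
  have C: "C > 0" and L: "L > 0"
    using assms(4,6) by (auto simp: C_def L_def)
  have p2: "smallest_prime_factor b \<ge> 2"
    using prime_smallest_prime_factor[OF assms(4)] by (rule prime_ge_2_nat)
  then have alpha: "wafom_alpha b > 0"
    by (simp add: wafom_alpha_def)
  have y: "y > 0"
    using alpha assms(8) by (simp add: y_def)
  have yL: "(1 + c) * C \<le> y * L"
    using assms(9) alpha L by (simp add: C_def L_def y_def field_simps)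
  have t: "t > 0"
    using assms(5) L by (simp add: t_def)
  have X: "X \<ge> 0"
    using C by (simp add: X_def)
  have m: "real m \<le> X" "X < real m + 1"
    using X by (auto simp: m_def)
  have vol: "real (card {A \<in> carrier ?D. dick_weight G s n A \<le> k}) \<le> exp (2 * sqrt (C * real k))" for k
    using card_dick_weight_le[OF is_group assms(2-4,6)] by (simp add: C_def)
  have "card {A \<in> carrier ?D. dick_weight G s n A \<le> m} \<le> smallest_prime_factor b ^ d"
  proof -
    have "sqrt (C * real m) \<le> sqrt (y\<^sup>2)"
      using m(1) C by (intro real_sqrt_le_mono) (simp add: X_def field_simps)
    then have "exp (2 * sqrt (C * real m)) \<le> exp (2 * y)"
      using y by simp
    also have "\<dots> = exp (real d * ln (real (smallest_prime_factor b)))"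
      by (simp add: y_def wafom_alpha_def)
    also have "\<dots> = real (smallest_prime_factor b ^ d)"
      using p2 by (simp add: exp_of_nat_mult)
    finally show ?thesis
      using vol[of m] by (simp only: flip: of_nat_le_iff[where 'a=real])
  qed
  then obtain P where P: "subgroup P (matrix_group s n G)" "card P \<le> b ^ d"
      "\<And>A. A \<in> perp G s n P - {\<one>\<^bsub>?D\<^esub>} \<Longrightarrow> m < dick_weight G s n A"
    using exists_subgroup_large_min_weight[OF assms(1-4)] by blast
  define Q where "Q = perp G s n P - {\<one>\<^bsub>?D\<^esub>}"
  define E where "E = exp (2 * y - X * L)"
  have finD: "finite (carrier ?D)"
    using finite_character_group[OF is_group assms(2)]
    by (auto simp: matrix_group_def intro!: finite_PiE)
  have "wafom G s n P = (\<Sum>A\<in>Q. exp (- (real (dick_weight G s n A) * L)))"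
    using assms(3,4) by (simp add: wafom_def Q_def powr_def L_def)
  also have "\<dots> \<le> E / (1 - exp (- t))"
  proof (rule sum_over_tail_le[where m = m and \<mu> = "dick_weight G s n"])
    show "finite Q"
      using finite_perp[OF is_group assms(2)] by (simp add: Q_def)
    fix j
    let ?k = "Suc m + j"
    have "card {A \<in> Q. dick_weight G s n A = ?k} \<le> card {A \<in> carrier ?D. dick_weight G s n A \<le> ?k}"
      using finD by (intro card_mono) (auto simp: Q_def perp_def)
    then have "real (card {A \<in> Q. dick_weight G s n A = ?k}) \<le> exp (2 * sqrt (C * real ?k))"
      using vol[of ?k] by linarith
    then have "real (card {A \<in> Q. dick_weight G s n A = ?k}) * exp (- (real ?k * L))
        \<le> exp (2 * sqrt (C * real ?k)) * exp (- (real ?k * L))"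
      by (rule mult_right_mono) simp
    also have "\<dots> = exp (2 * sqrt (C * real ?k) - real ?k * L)"
      by (simp flip: exp_add)
    also have "\<dots> \<le> exp (2 * y - X * L - t * real j)"
      unfolding X_def t_def exp_le_cancel_iff
      using C y assms(5) L yL m(2) by (intro two_sqrt_minus_linear_le) (auto simp: X_def)
    also have "\<dots> = E * exp (- t) ^ j"
      by (simp add: E_def mult.commute flip: exp_of_nat_mult exp_add)
    finally show "real (card {A \<in> Q. dick_weight G s n A = ?k}) * exp (- (real ?k * L)) \<le> E * exp (- t) ^ j" .
  qed (use t P(3) in \<open>auto simp: Q_def E_def\<close>)
  also have "\<dots> = 1 / (1 - exp (- t)) * E"
    by simp
  also have "\<dots> \<le> (1 + 1 / t) * E"
    by (intro mult_right_mono inverse_one_minus_exp_le[OF t]) (simp add: E_def)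
  also have "\<dots> = (1 + (1 + c) / c * (1 / L)) * (exp (- X * L) * exp (2 * y))"
    by (simp add: t_def E_def flip: exp_add)
  also have "exp (- X * L) = real b powr (- X)"
    using assms(4) by (simp add: powr_def L_def)
  finally show ?thesis
    using P(1,2) by (intro exI[of _ P]) (simp add: L_def X_def y_def C_def power_mult_distrib mult_ac)
qed

end
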